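(* For $\mu>0$ (and every $x\in\mathbb R^{dn}$, $c_0>0$), $$\mathbb L(x,c_0)\ \le\ \tilde{\mathbb L}(x,\mu,c_0)\ \le\ \mathbb L(x,c_0)+\mu\log r,$$ where $$\mathbb L(x,c_0)=\max_{0\le k\le r}\frac{f_k(x)}{c_k},\qquad \tilde{\mathbb L}(x,\mu,c_0)=\mu\log\sum_{k=1}^{r}\exp\left\{\frac1\mu\times\frac{f_k(x)}{c_k}\right\}.$$
   Context: Network data: positive integers $d,n$; a set $N=\{e_1,\dots,e_{n_0}\}$ of $n_0$ edges, each $e_k=\{i,j\}$ an unordered pair of distinct nodes in $\{1,\dots,n\}$; for each edge $e_k$ real bounds $0<\underline d_k\le\overline d_k$ on its length. Points of $\mathbb R^{dn}$ are written $x=(x_1,\dots,x_n)$ with $x_i\in\mathbb R^d$, and $\|\cdot\|$ is the Euclidean norm. Functions: $f_0(x)=\sum_{i=1}^n\|x_i\|^2$. For $1\le k\le n_0$ with $e_k=\{i,j\}$, $f_k(x)=\|x_i-x_j\|^2$ and $f_{n_0+k}(x)=2\underline d_k^2-f_k(x)$. Put $r=2n_0$, $c_k=\overline d_k^2$ for $1\le k\le n_0$, and $c_k=\underline d_{k-n_0}^2$ for $n_0+1\le k\le r$ (so all these $c_k>0$). The number $c_0>0$ is a free parameter independent of $x$.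
   Formalization: The printed lower bound fails for small c_0 since the sum omits k=0. Proved instead: with the sum over 1..r, the lower bound has the max over 1..r and the upper bound is as printed; with the sum over 0..r, both bounds hold for the printed max, with error μ log(r+1). *)

theory Defs
  imports "HOL-Analysis.Analysis"
begin

text \<open>A point of \<open>\<real>\<^sup>d\<^sup>n\<close> is a vector \<open>x :: real^'d^'n\<close> whose \<open>i\<close>-th block is \<open>x $ i\<close>;
  the nodes are the elements of the finite type \<open>'n\<close>. The edges are \<open>e k\<close> for \<open>k \<in> {1..n0}\<close>.\<close>

definition sq_edge_length :: "'n set \<Rightarrow> real^'d^'n::finite \<Rightarrow> real" where
  "sq_edge_length E x = (THE t. \<exists>i j. E = {i, j} \<and> t = (norm (x $ i - x $ j))\<^sup>2)"

lemma sq_edge_length_pair: "sq_edge_length {i, j} x = (norm (x $ i - x $ j))\<^sup>2"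
  unfolding sq_edge_length_def
  by (rule the_equality) (auto simp: doubleton_eq_iff norm_minus_commute)

definition net_f ::
    "nat \<Rightarrow> (nat \<Rightarrow> 'n set) \<Rightarrow> (nat \<Rightarrow> real) \<Rightarrow> nat \<Rightarrow> real^'d^'n::finite \<Rightarrow> real" where
  "net_f n0 e dlo k x =
     (if k = 0 then \<Sum>i\<in>UNIV. (norm (x $ i))\<^sup>2
      else if k \<le> n0 then sq_edge_length (e k) x
      else 2 * (dlo (k - n0))\<^sup>2 - sq_edge_length (e (k - n0)) x)"

definition net_c ::
    "nat \<Rightarrow> (nat \<Rightarrow> real) \<Rightarrow> (nat \<Rightarrow> real) \<Rightarrow> real \<Rightarrow> nat \<Rightarrow> real" where
  "net_c n0 dlo dhi c0 k =
     (if k = 0 then c0 else if k \<le> n0 then (dhi k)\<^sup>2 else (dlo (k - n0))\<^sup>2)"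

text \<open>The two functions below take the set \<open>K\<close> of indices \<open>k\<close> as a parameter:
  \<open>{0..2 * n0}\<close> includes the term \<open>f\<^sub>0/c\<^sub>0\<close>, and \<open>{1..2 * n0}\<close> leaves it out. With the maximum over
  the former and the sum over the latter, \<open>net_L \<le> net_Lsmooth\<close> fails for small \<open>c0\<close> when \<open>x \<noteq> 0\<close>.\<close>

definition net_L ::
    "nat set \<Rightarrow> nat \<Rightarrow> (nat \<Rightarrow> 'n set) \<Rightarrow> (nat \<Rightarrow> real) \<Rightarrow> (nat \<Rightarrow> real) \<Rightarrow>
     real^'d^'n::finite \<Rightarrow> real \<Rightarrow> real" where
  "net_L K n0 e dlo dhi x c0 = (MAX k\<in>K. net_f n0 e dlo k x / net_c n0 dlo dhi c0 k)"

definition net_Lsmooth ::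
    "nat set \<Rightarrow> nat \<Rightarrow> (nat \<Rightarrow> 'n set) \<Rightarrow> (nat \<Rightarrow> real) \<Rightarrow> (nat \<Rightarrow> real) \<Rightarrow>
     real^'d^'n::finite \<Rightarrow> real \<Rightarrow> real \<Rightarrow> real" where
  "net_Lsmooth K n0 e dlo dhi x \<mu> c0 =
     \<mu> * ln (\<Sum>k\<in>K. exp (1 / \<mu> * (net_f n0 e dlo k x / net_c n0 dlo dhi c0 k)))"

end

theory Submission
  imports Defs
begin

text \<open>For finitely many reals \<open>g k\<close> with maximum \<open>M\<close>, the sum of the
  \<open>exp (g k / \<mu>)\<close> is at least its largest term \<open>exp (M / \<mu>)\<close> and
  at most \<open>card K\<close> copies of it. Applying the increasing map \<open>\<mu> * ln\<close>
  turns these two estimates into \<open>Max_le_log_sum_exp\<close> and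
  \<open>log_sum_exp_le\<close>; the theorem applies them to the quotients of \<open>net_f\<close>
  by \<open>net_c\<close>.\<close>

lemma Max_le_log_sum_exp:
  fixes g :: "'a \<Rightarrow> real"
  assumes "finite K" "K \<noteq> {}" "\<mu> > 0"
  shows "(MAX k\<in>K. g k) \<le> \<mu> * ln (\<Sum>k\<in>K. exp (1 / \<mu> * g k))"
proof -
  have "g k \<le> \<mu> * ln (\<Sum>k\<in>K. exp (1 / \<mu> * g k))" if "k \<in> K" for k
  proof -
    have "exp (1 / \<mu> * g k) \<le> (\<Sum>k\<in>K. exp (1 / \<mu> * g k))"
      using \<open>finite K\<close> that by (intro member_le_sum) auto
    then have "1 / \<mu> * g k \<le> ln (\<Sum>k\<in>K. exp (1 / \<mu> * g k))"
      using \<open>finite K\<close> \<open>K \<noteq> {}\<close> by (subst ln_ge_iff) (auto intro: sum_pos)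
    then show ?thesis
      using \<open>\<mu> > 0\<close> by (simp add: field_simps)
  qed
  then show ?thesis
    using assms by simp
qed

text \<open>Each summand is at most \<open>exp (M / \<mu>)\<close>, and the number of summands
  becomes the additive error \<open>\<mu> * ln (card K)\<close>. Allowing any upper bound
  \<open>M\<close> lets the maximum be taken over a larger index set than the sum.\<close>

lemma log_sum_exp_le:
  fixes g :: "'a \<Rightarrow> real"
  assumes "finite K" "K \<noteq> {}" "\<mu> > 0" and le: "\<And>k. k \<in> K \<Longrightarrow> g k \<le> M"
  shows "\<mu> * ln (\<Sum>k\<in>K. exp (1 / \<mu> * g k)) \<le> M + \<mu> * ln (real (card K))"
proof -
  have card: "real (card K) > 0"
    using assms by (simp add: card_gt_0_iff)
  have "(\<Sum>k\<in>K. exp (1 / \<mu> * g k)) \<le> (\<Sum>k\<in>K. exp (M / \<mu>))"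
    using \<open>\<mu> > 0\<close> le by (intro sum_mono) (simp add: divide_right_mono)
  then have "ln (\<Sum>k\<in>K. exp (1 / \<mu> * g k)) \<le> ln (real (card K) * exp (M / \<mu>))"
    using assms card by (subst ln_le_cancel_iff) (auto intro: sum_pos)
  also have "\<dots> = ln (real (card K)) + M / \<mu>"
    using card by (simp add: ln_mult)
  finally show ?thesis
    using \<open>\<mu> > 0\<close> by (simp add: field_simps)
qed

text \<open>The index 0 needs care: if x is nonzero, the quotient for k = 0 grows without bound as
  \<open>c0\<close> tends to 0, while a sum over \<open>{1..r}\<close> does not depend on
  \<open>c0\<close>. Hence each lower bound uses the same index set on both sides, and including 0
  in the sum costs \<open>ln (r + 1)\<close> instead of \<open>ln r\<close>.\<close>

theorem theorem3:
  fixes n0 r :: nat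
    and e :: "nat \<Rightarrow> 'n::finite set"
    and dlo dhi :: "nat \<Rightarrow> real"
    and x :: "real^'d::finite^'n"
    and c0 \<mu> :: real
  assumes n0: "n0 \<ge> 1"
    and r: "r = 2 * n0"
    and edges: "\<And>k. k \<in> {1..n0} \<Longrightarrow> \<exists>i j. i \<noteq> j \<and> e k = {i, j}"
    and distinct_edges: "inj_on e {1..n0}"
    and bounds: "\<And>k. k \<in> {1..n0} \<Longrightarrow> 0 < dlo k \<and> dlo k \<le> dhi k"
    and c0: "c0 > 0"
    and mu: "\<mu> > 0"
  shows "(net_L {0..r} n0 e dlo dhi x c0 \<le> net_Lsmooth {0..r} n0 e dlo dhi x \<mu> c0
          \<and> net_Lsmooth {0..r} n0 e dlo dhi x \<mu> c0
              \<le> net_L {0..r} n0 e dlo dhi x c0 + \<mu> * ln (real (r + 1)))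
       \<and> (net_L {1..r} n0 e dlo dhi x c0 \<le> net_Lsmooth {1..r} n0 e dlo dhi x \<mu> c0
          \<and> net_Lsmooth {1..r} n0 e dlo dhi x \<mu> c0
              \<le> net_L {0..r} n0 e dlo dhi x c0 + \<mu> * ln (real r))"
proof -
  have lower: "net_L K n0 e dlo dhi x c0 \<le> net_Lsmooth K n0 e dlo dhi x \<mu> c0"
    if "finite K" "K \<noteq> {}" for K
    unfolding net_L_def net_Lsmooth_def by (rule Max_le_log_sum_exp[OF that mu])
  \<comment> \<open>Here \<open>M\<close> is the maximum over all of \<open>{0..r}\<close>, which
    dominates every term with index in \<open>K\<close>.\<close>
  have upper: "net_Lsmooth K n0 e dlo dhi x \<mu> c0
      \<le> net_L {0..r} n0 e dlo dhi x c0 + \<mu> * ln (real (card K))"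
    if "K \<subseteq> {0..r}" "K \<noteq> {}" for K
    unfolding net_L_def net_Lsmooth_def
    using that mu by (intro log_sum_exp_le Max_ge) (auto intro: finite_subset)
  \<comment> \<open>At least one edge is needed here, since \<open>Max\<close> of the empty set is
    unspecified.\<close>
  have "{1..r} \<noteq> {}"
    using n0 r by simp
  then show ?thesis
    using lower[of "{0..r}"] lower[of "{1..r}"] upper[of "{0..r}"] upper[of "{1..r}"] by simp
qed

end
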